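(* Let $f\in L^1(S^1,\mathbb R)$ have Fourier coefficients $c_k$ and nonlinear coefficients $s_k$. The transformation rules between the coefficients $s_k$ and $c_k$ are algebraic: for every $k\ge 1$ there exist polynomials $P$ and $Q$ of degree $k$ in $k$ variables, whose complex coefficients depend only on $k$ and $c_0$, such that $$s_k=P(c_1,\dots,c_k)\qquad\text{and}\qquad c_k=Q(s_1,\dots,s_k).$$ (Here the polynomials do not otherwise depend on $f$: the same $P$ and $Q$ work for all $f\in L^1(S^1,\mathbb R)$ with the given value of $c_0$.)
   Context: The unit circle $S^1$ is parametrized by $t\in[0,2\pi)$. For $f\in L^1(S^1,\mathbb R)$ and $k\in\mathbb Z$, $c_k=c_k(f)=\frac1{2\pi}\int_0^{2\pi}f(t)e^{ikt}\,dt$. The nonlinear coefficients $s_k\in\mathbb C$, $k\ge 1$, of $f$ are defined by the power series identity on the unit disc $|z|<1$ $$\exp\Big(-2\pi i\sum_{k=1}^\infty c_kz^k\Big)=1-i\,e^{\pi i c_0}\sum_{k=1}^\infty s_kz^k .$$ *)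

theory Defs
  imports "HOL-Complex_Analysis.Complex_Analysis" "HOL-Library.Poly_Mapping"
begin

definition fourier_coeff :: "(real \<Rightarrow> real) \<Rightarrow> int \<Rightarrow> complex" where
  "fourier_coeff f k =
     1 / (2 * of_real pi) *
     (LINT t:{0..<2 * pi}|lebesgue. of_real (f t) * exp (\<i> * of_int k * of_real t))"

definition is_nonlinear_coeffs :: "(real \<Rightarrow> real) \<Rightarrow> (nat \<Rightarrow> complex) \<Rightarrow> bool" where
  "is_nonlinear_coeffs f s \<longleftrightarrow>
     (\<forall>z. norm z < 1 \<longrightarrow>
        summable (\<lambda>k. s (Suc k) * z ^ Suc k) \<and>
        exp (- 2 * of_real pi * \<i> * suminf (\<lambda>k. fourier_coeff f (int (Suc k)) * z ^ Suc k)) =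
          1 - \<i> * exp (of_real pi * \<i> * fourier_coeff f 0) * suminf (\<lambda>k. s (Suc k) * z ^ Suc k))"

text \<open>The coefficients are indexed from 1; the value at index 0 is fixed to be 0 only to make the
  sequence unique.  Existence and uniqueness are shown in \<open>nonlinear_coeff_ex1\<close> below.\<close>

definition nonlinear_coeff :: "(real \<Rightarrow> real) \<Rightarrow> nat \<Rightarrow> complex" where
  "nonlinear_coeff f = (THE s. s 0 = 0 \<and> is_nonlinear_coeffs f s)"

lemma fourier_coeff_bound:
  "norm (fourier_coeff f k) \<le> (LINT t:{0..<2 * pi}|lebesgue. \<bar>f t\<bar>) / (2 * pi)"
proof -
  have "norm (LINT t:{0..<2 * pi}|lebesgue. of_real (f t) * exp (\<i> * of_int k * of_real t))
      \<le> (LINT t|lebesgue. norm (indicator {0..<2 * pi} t *\<^sub>R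
           (of_real (f t) * exp (\<i> * of_int k * of_real t))))"
    unfolding set_lebesgue_integral_def by (rule integral_norm_bound)
  also have "\<dots> = (LINT t:{0..<2 * pi}|lebesgue. \<bar>f t\<bar>)"
    unfolding set_lebesgue_integral_def by (simp add: norm_mult)
  finally show ?thesis
    by (simp add: fourier_coeff_def norm_mult norm_divide divide_right_mono)
qed

lemma fourier_series_summable:
  assumes "norm z < 1"
  shows "summable (\<lambda>k. fourier_coeff f (int (Suc k)) * z ^ Suc k)"
proof (rule summable_comparison_test')
  show "summable (\<lambda>k. (LINT t:{0..<2 * pi}|lebesgue. \<bar>f t\<bar>) / (2 * pi) * norm z ^ Suc k)"
    using assms by (intro summable_mult) (simp add: summable_geometric)
  show "norm (fourier_coeff f (int (Suc k)) * z ^ Suc k)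
      \<le> (LINT t:{0..<2 * pi}|lebesgue. \<bar>f t\<bar>) / (2 * pi) * norm z ^ Suc k"
    if "k \<ge> 0" for k
    unfolding norm_mult norm_power
    by (rule mult_right_mono[OF fourier_coeff_bound]) simp
qed

lemma sums_shift:
  assumes "s 0 = 0" "(\<lambda>k. s k * z ^ k) sums (l :: complex)"
  shows "(\<lambda>k. s (Suc k) * z ^ Suc k) sums l"
  using assms sums_Suc_iff[of "\<lambda>k. s k * z ^ k" l] by simp

lemma powser_ball_unique:
  fixes a b :: "nat \<Rightarrow> complex"
  assumes "\<And>z. norm z < 1 \<Longrightarrow> (\<lambda>k. a k * z ^ k) sums g z"
    and "\<And>z. norm z < 1 \<Longrightarrow> (\<lambda>k. b k * z ^ k) sums g z"
  shows "a = b"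
proof -
  define F where "F = Abs_fps a"
  define G where "G = Abs_fps b"
  have radius: "fps_conv_radius (Abs_fps c) > 0"
    if "\<And>z. norm z < 1 \<Longrightarrow> (\<lambda>k. c k * z ^ k) sums g z" for c :: "nat \<Rightarrow> complex"
  proof -
    have "summable (\<lambda>k. c k * (1 / 2) ^ k)"
      using that[of "1 / 2"] by (simp add: sums_iff)
    then have "ereal (norm (1 / 2 :: complex)) \<le> fps_conv_radius (Abs_fps c)"
      unfolding fps_conv_radius_def by (intro conv_radius_geI) simp
    moreover have "0 < ereal (norm (1 / 2 :: complex))"
      by simp
    ultimately show ?thesis
      by (rule order_less_le_trans[rotated])
  qed
  have "eventually (\<lambda>z. z \<in> ball (0 :: complex) 1) (nhds 0)"
    by (intro eventually_nhds_in_open) auto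
  then have "eventually (\<lambda>z. eval_fps F z = eval_fps G z) (nhds 0)"
    by eventually_elim (use assms in \<open>auto simp: eval_fps_def F_def G_def sums_iff\<close>)
  then have "F = G"
    using radius assms unfolding F_def G_def by (intro eval_fps_eqD) auto
  then show ?thesis
    unfolding F_def G_def fps_eq_iff by auto
qed

lemma nonlinear_coeff_ex1: "\<exists>!s. s 0 = 0 \<and> is_nonlinear_coeffs f s"
proof -
  define c where "c = (\<lambda>k. if k = 0 then 0 else fourier_coeff f (int k))"
  define g where "g = (\<lambda>z. suminf (\<lambda>k. fourier_coeff f (int (Suc k)) * z ^ Suc k))"
  define e where "e = \<i> * exp (of_real pi * \<i> * fourier_coeff f 0)"
  have g_eq: "suminf (\<lambda>k. fourier_coeff f (int (Suc k)) * z ^ Suc k) = g z" for z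
    by (simp add: g_def)
  have e: "e \<noteq> 0"
    by (simp add: e_def)
  define h where "h = (\<lambda>z. (1 - exp (- 2 * of_real pi * \<i> * g z)) / e)"
  have c_sums: "(\<lambda>k. c k * (z - 0) ^ k) sums g z" if "z \<in> ball 0 1" for z
  proof -
    have "(\<lambda>k. c (Suc k) * z ^ Suc k) sums g z"
      using fourier_series_summable[of z f] that
      by (auto simp: c_def g_def intro: summable_sums)
    then show ?thesis
      using sums_Suc_iff[of "\<lambda>k. c k * z ^ k" "g z"] by (simp add: c_def)
  qed
  have "g holomorphic_on ball 0 1"
    by (rule power_series_holomorphic[OF c_sums])
  then have "h holomorphic_on ball 0 1"
    unfolding h_def using e by (intro holomorphic_intros) auto
  define s where "s = (\<lambda>n. (deriv ^^ n) h 0 / fact n)"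
  have s_sums: "(\<lambda>n. s n * z ^ n) sums h z" if "norm z < 1" for z
    using holomorphic_power_series[OF \<open>h holomorphic_on ball 0 1\<close>, of z] that
    by (simp add: s_def)
  have "s 0 = 0"
    by (simp add: s_def h_def g_def)
  have h_id: "exp (- 2 * of_real pi * \<i> * g z) = 1 - e * h z" for z
    using e by (simp add: h_def)
  have iff: "is_nonlinear_coeffs f r \<longleftrightarrow>
      (\<forall>z. norm z < 1 \<longrightarrow> (\<lambda>k. r (Suc k) * z ^ Suc k) sums h z)" for r
  proof -
    have "1 - e * h z = 1 - e * x \<longleftrightarrow> x = h z" for z x
      using e by auto
    then show ?thesis
      unfolding is_nonlinear_coeffs_def g_eq e_def[symmetric] h_id sums_iff by metis
  qed
  show ?thesis
  proof (rule ex1I[of _ s])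
    show "s 0 = 0 \<and> is_nonlinear_coeffs f s"
      using \<open>s 0 = 0\<close> s_sums sums_shift unfolding iff by blast
  next
    fix r assume r: "r 0 = 0 \<and> is_nonlinear_coeffs f r"
    have "(\<lambda>k. r k * z ^ k) sums h z" if "norm z < 1" for z
      using r that sums_Suc_iff[of "\<lambda>k. r k * z ^ k" "h z"] unfolding iff by simp
    then show "r = s"
      using s_sums by (rule powser_ball_unique)
  qed
qed

text \<open>Polynomials in the variables \<open>x\<^sub>0, x\<^sub>1, \<dots>\<close>: finitely supported maps from
  monomials (exponent vectors) to coefficients.\<close>

type_synonym 'a multipoly = "(nat \<Rightarrow>\<^sub>0 nat) \<Rightarrow>\<^sub>0 'a"

definition multipoly_vars :: "'a::zero multipoly \<Rightarrow> nat set" where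
  "multipoly_vars p = (\<Union>m\<in>Poly_Mapping.keys p. Poly_Mapping.keys m)"

definition total_degree :: "'a::zero multipoly \<Rightarrow> nat" where
  "total_degree p =
     Max (insert 0 ((\<lambda>m. \<Sum>i\<in>Poly_Mapping.keys m. Poly_Mapping.lookup m i) ` Poly_Mapping.keys p))"

definition multipoly_eval :: "'a::comm_semiring_1 multipoly \<Rightarrow> (nat \<Rightarrow> 'a) \<Rightarrow> 'a" where
  "multipoly_eval p x =
     (\<Sum>m\<in>Poly_Mapping.keys p. Poly_Mapping.lookup p m *
        (\<Prod>i\<in>Poly_Mapping.keys m. x i ^ Poly_Mapping.lookup m i))"

end

theory Submission
  imports Defs
begin

text \<open>Differentiating \<open>exp (w A) = 1 - e S\<close>, where \<open>A = \<Sum> c\<^sub>k z\<^sup>k\<close>, \<open>S = \<Sum> s\<^sub>k z\<^sup>k\<close>, \<open>w = -2\<pi>i\<close> and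
  \<open>e = i e\<^bsup>\<pi>ic\<^sub>0\<^esup>\<close>, gives \<open>-e S' = w A' (1 - e S)\<close>. Comparing coefficients, this can be solved both for
  \<open>s\<^sub>n\<close> and for \<open>c\<^sub>n\<close>, and either way it has the shape
  \<open>y\<^sub>n = \<alpha>\<^sub>n x\<^sub>n + \<Sum>\<^bsub>0<j<n\<^esub> \<beta>\<^sub>n\<^sub>j x\<^sub>j y\<^bsub>n-j\<^esub>\<close>. Hence \<open>y\<^sub>n\<close> is a polynomial in \<open>x\<^sub>1, \<dots>, x\<^sub>n\<close> of degree at most
  \<open>n\<close>; the degree is exactly \<open>n\<close> because the coefficient of \<open>x\<^sub>1\<^sup>n\<close> is \<open>\<alpha>\<^sub>1 \<beta>\<^sub>2\<^sub>1 \<cdots> \<beta>\<^sub>n\<^sub>1 \<noteq> 0\<close>.\<close>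

section \<open>Multivariate polynomials\<close>

definition monom_eval :: "(nat \<Rightarrow>\<^sub>0 nat) \<Rightarrow> (nat \<Rightarrow> 'a::comm_semiring_1) \<Rightarrow> 'a" where
  "monom_eval m x = (\<Prod>i\<in>Poly_Mapping.keys m. x i ^ Poly_Mapping.lookup m i)"

definition monom_degree :: "(nat \<Rightarrow>\<^sub>0 nat) \<Rightarrow> nat" where
  "monom_degree m = (\<Sum>i\<in>Poly_Mapping.keys m. Poly_Mapping.lookup m i)"

lemma keys_plus_nat:
  "Poly_Mapping.keys (m + m' :: nat \<Rightarrow>\<^sub>0 nat) = Poly_Mapping.keys m \<union> Poly_Mapping.keys m'"
  by (auto simp: in_keys_iff lookup_add)

text \<open>Indices outside the support contribute \<open>x i ^ 0 = 1\<close>. Enlarging the index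
  set lets several monomials be compared factor by factor over one common set.\<close>

lemma monom_eval_superset:
  assumes "finite A" "Poly_Mapping.keys m \<subseteq> A"
  shows "monom_eval m x = (\<Prod>i\<in>A. x i ^ Poly_Mapping.lookup m i)"
  unfolding monom_eval_def using assms
  by (intro prod.mono_neutral_left) (auto simp: in_keys_iff)

lemma monom_degree_superset:
  assumes "finite A" "Poly_Mapping.keys m \<subseteq> A"
  shows "monom_degree m = (\<Sum>i\<in>A. Poly_Mapping.lookup m i)"
  unfolding monom_degree_def using assms
  by (intro sum.mono_neutral_left) (auto simp: in_keys_iff)

lemma monom_eval_add: "monom_eval (m + m') x = monom_eval m x * monom_eval m' x"
proof -
  let ?A = "Poly_Mapping.keys m \<union> Poly_Mapping.keys m'"
  have "monom_eval n x = (\<Prod>i\<in>?A. x i ^ Poly_Mapping.lookup n i)" if "n \<in> {m, m', m + m'}" for n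
    using that by (intro monom_eval_superset) (auto simp: keys_plus_nat)
  then show ?thesis
    by (simp add: lookup_add power_add prod.distrib)
qed

lemma monom_degree_add: "monom_degree (m + m') = monom_degree m + monom_degree m'"
proof -
  let ?A = "Poly_Mapping.keys m \<union> Poly_Mapping.keys m'"
  have "monom_degree n = (\<Sum>i\<in>?A. Poly_Mapping.lookup n i)" if "n \<in> {m, m', m + m'}" for n
    using that by (intro monom_degree_superset) (auto simp: keys_plus_nat)
  then show ?thesis
    by (simp add: lookup_add sum.distrib)
qed

lemma monom_eval_single [simp]: "monom_eval (Poly_Mapping.single j n) x = x j ^ n"
  by (cases "n = 0") (auto simp: monom_eval_def)

lemma monom_degree_single [simp]: "monom_degree (Poly_Mapping.single j n) = n"
  by (cases "n = 0") (auto simp: monom_degree_def)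

lemma multipoly_eval_superset:
  assumes "finite A" "Poly_Mapping.keys p \<subseteq> A"
  shows "multipoly_eval p x = (\<Sum>m\<in>A. Poly_Mapping.lookup p m * monom_eval m x)"
  unfolding multipoly_eval_def monom_eval_def using assms
  by (intro sum.mono_neutral_left) (auto simp: in_keys_iff)

lemma multipoly_eval_zero [simp]: "multipoly_eval 0 x = 0"
  by (simp add: multipoly_eval_def)

lemma multipoly_eval_add: "multipoly_eval (p + q) x = multipoly_eval p x + multipoly_eval q x"
proof -
  let ?A = "Poly_Mapping.keys p \<union> Poly_Mapping.keys q"
  have "multipoly_eval r x = (\<Sum>m\<in>?A. Poly_Mapping.lookup r m * monom_eval m x)"
    if "r \<in> {p, q, p + q}" for r
    using that keys_add[of p q] by (intro multipoly_eval_superset) auto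
  then show ?thesis
    by (simp add: lookup_add distrib_right sum.distrib)
qed

lemma multipoly_eval_sum: "multipoly_eval (sum p A) x = (\<Sum>j\<in>A. multipoly_eval (p j) x)"
  by (induction A rule: infinite_finite_induct) (simp_all add: multipoly_eval_add)

lemma multipoly_eval_single: "multipoly_eval (Poly_Mapping.single m c) x = c * monom_eval m x"
  by (cases "c = 0") (auto simp: multipoly_eval_def monom_eval_def)

text \<open>Exponent vectors can be cancelled, so a single term of the convolution product
  survives.\<close>

lemma lookup_single_times:
  fixes p :: "'a::comm_semiring_1 multipoly"
  shows "Poly_Mapping.lookup (Poly_Mapping.single m c * p) (m + m') = c * Poly_Mapping.lookup p m'"
  by (simp add: lookup_mult lookup_single when_mult)

lemma keys_single_times_subset:
  fixes p :: "'a::comm_semiring_1 multipoly"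
  shows "Poly_Mapping.keys (Poly_Mapping.single m c * p) \<subseteq> (+) m ` Poly_Mapping.keys p"
  using keys_mult[of "Poly_Mapping.single m c" p] by (auto split: if_splits)

lemma multipoly_eval_single_times:
  "multipoly_eval (Poly_Mapping.single m c * p) x = c * monom_eval m x * multipoly_eval p x"
proof -
  \<comment> \<open>The sum runs over the shifted keys of \<open>p\<close>, a superset of the keys
    of the product, because multiplication by \<open>c\<close> may annihilate coefficients.\<close>
  have "multipoly_eval (Poly_Mapping.single m c * p) x =
      (\<Sum>m'\<in>(+) m ` Poly_Mapping.keys p.
        Poly_Mapping.lookup (Poly_Mapping.single m c * p) m' * monom_eval m' x)"
    by (intro multipoly_eval_superset keys_single_times_subset) auto
  also have "\<dots> = (\<Sum>m'\<in>Poly_Mapping.keys p.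
      c * monom_eval m x * (Poly_Mapping.lookup p m' * monom_eval m' x))"
    by (subst sum.reindex)
      (auto simp: inj_on_def lookup_single_times monom_eval_add intro!: sum.cong, simp add: mult_ac)
  also have "\<dots> = c * monom_eval m x * multipoly_eval p x"
    by (simp add: multipoly_eval_superset[of "Poly_Mapping.keys p"] sum_distrib_left)
  finally show ?thesis .
qed

lemma total_degree_eqI:
  assumes "\<And>m. m \<in> Poly_Mapping.keys p \<Longrightarrow> monom_degree m \<le> n"
    and "m \<in> Poly_Mapping.keys p" "monom_degree m = n"
  shows "total_degree p = n"
  unfolding total_degree_def monom_degree_def[symmetric]
  using assms by (intro Max_eqI) auto

section \<open>Polynomial solutions of convolution recurrences\<close>

definition conv_recurrence ::
    "(nat \<Rightarrow> 'a) \<Rightarrow> (nat \<Rightarrow> nat \<Rightarrow> 'a) \<Rightarrow> (nat \<Rightarrow> 'a) \<Rightarrow> (nat \<Rightarrow> 'a::comm_semiring_1) \<Rightarrow> bool" where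
  "conv_recurrence \<alpha> \<beta> x y \<longleftrightarrow>
     (\<forall>n\<ge>1. y n = \<alpha> n * x n + (\<Sum>j=1..<n. \<beta> n j * x j * y (n - j)))"

text \<open>Strong induction: substituting the polynomials already found for the earlier
  \<open>y (k - j)\<close> gives the next one. It is fixed before \<open>x\<close> and
  \<open>y\<close>, which later makes it independent of \<open>f\<close>. In an integral domain the
  product giving the coefficient of \<open>x 1 ^ k\<close> cannot vanish.\<close>

lemma conv_recurrence_multipoly:
  fixes \<alpha> :: "nat \<Rightarrow> 'a::idom" and \<beta> :: "nat \<Rightarrow> nat \<Rightarrow> 'a"
  assumes "\<alpha> 1 \<noteq> 0" and "\<And>n. n \<ge> 2 \<Longrightarrow> \<beta> n 1 \<noteq> 0" and "k \<ge> 1"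
  obtains P :: "'a multipoly" where "multipoly_vars P \<subseteq> {1..k}" "total_degree P = k"
    "\<And>x y. conv_recurrence \<alpha> \<beta> x y \<Longrightarrow> y k = multipoly_eval P x"
proof -
  \<comment> \<open>The invariant tracks the coefficient of one monomial of degree \<open>k\<close>:
    exact degree alone would not survive the induction, since leading terms of different summands
    could cancel.\<close>
  define good where "good k P \<longleftrightarrow> Poly_Mapping.lookup P (Poly_Mapping.single 1 k) \<noteq> 0 \<and>
    (\<forall>m\<in>Poly_Mapping.keys P. Poly_Mapping.keys m \<subseteq> {1..k} \<and> monom_degree m \<le> k) \<and>
    (\<forall>x y. conv_recurrence \<alpha> \<beta> x y \<longrightarrow> y k = multipoly_eval P x)"
    for k and P :: "'a multipoly"
  have "\<exists>P. good k P"
    using \<open>k \<ge> 1\<close>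
  proof (induction k rule: less_induct)
    case (less k)
    then have "\<forall>n\<in>{1..<k}. \<exists>P. good n P"
      by auto
    then obtain R where R: "\<And>n. n \<in> {1..<k} \<Longrightarrow> good n (R n)"
      by metis
    define T where "T j = Poly_Mapping.single (Poly_Mapping.single j 1) (\<beta> k j) * R (k - j)" for j
    define P where "P = Poly_Mapping.single (Poly_Mapping.single k 1) (\<alpha> k) + (\<Sum>j=1..<k. T j)"
    have T_keys: "\<exists>m'\<in>Poly_Mapping.keys (R (k - j)). m = Poly_Mapping.single j 1 + m'"
      if "m \<in> Poly_Mapping.keys (T j)" for m j
      using that keys_single_times_subset unfolding T_def by blast
    \<comment> \<open>Every monomial of \<open>T j\<close> contains the variable with index
      \<open>j\<close>, so only \<open>T 1\<close> can contribute to a pure power of the first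
      variable.\<close>
    have T_lookup: "Poly_Mapping.lookup (T j) (Poly_Mapping.single 1 k) =
        (if j = 1 then \<beta> k 1 * Poly_Mapping.lookup (R (k - 1)) (Poly_Mapping.single 1 (k - 1)) else 0)"
      if "j \<in> {1..<k}" for j
    proof (cases "j = 1")
      case True
      have "Poly_Mapping.single 1 k = Poly_Mapping.single 1 1 + Poly_Mapping.single (1::nat) (k - 1)"
        using less.prems by (simp flip: single_add)
      then show ?thesis
        using True by (simp add: T_def lookup_single_times)
    next
      case False
      have "Poly_Mapping.single 1 k \<notin> Poly_Mapping.keys (T j)"
      proof
        assume "Poly_Mapping.single 1 k \<in> Poly_Mapping.keys (T j)"
        then obtain m' where m': "Poly_Mapping.single 1 k = Poly_Mapping.single j 1 + m'"
          using T_keys by blast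
        have "Poly_Mapping.lookup (Poly_Mapping.single 1 k) j = (0::nat)"
          using False by (simp add: lookup_single)
        then show False
          unfolding m' by (simp add: lookup_add)
      qed
      then show ?thesis
        using False by (simp add: in_keys_iff)
    qed
    have "Poly_Mapping.lookup P (Poly_Mapping.single 1 k) \<noteq> 0"
    proof (cases "k = 1")
      case True
      then show ?thesis
        using assms by (simp add: P_def)
    next
      case False
      then have "k \<ge> 2"
        using less.prems by simp
      \<comment> \<open>For \<open>k\<close> at least 2 the linear term of \<open>P\<close> is a
        different monomial, so it cannot cancel the contribution of \<open>T 1\<close>.\<close>
      have "Poly_Mapping.single k 1 \<noteq> Poly_Mapping.single 1 k"
      proof
        assume "Poly_Mapping.single k 1 = Poly_Mapping.single 1 k"
        then have "Poly_Mapping.lookup (Poly_Mapping.single k 1) k =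
            Poly_Mapping.lookup (Poly_Mapping.single 1 k) k"
          by simp
        then show False
          using False by (simp add: lookup_single)
      qed
      then have "Poly_Mapping.lookup P (Poly_Mapping.single 1 k) =
          (\<Sum>j=1..<k. Poly_Mapping.lookup (T j) (Poly_Mapping.single 1 k))"
        by (simp add: P_def lookup_add lookup_sum lookup_single)
      also have "\<dots> = (\<Sum>j=1..<k. if j = 1 then
          \<beta> k 1 * Poly_Mapping.lookup (R (k - 1)) (Poly_Mapping.single 1 (k - 1)) else 0)"
        by (intro sum.cong refl T_lookup)
      also have "\<dots> = \<beta> k 1 * Poly_Mapping.lookup (R (k - 1)) (Poly_Mapping.single 1 (k - 1))"
        using \<open>k \<ge> 2\<close> by simp
      finally show ?thesis
        using assms(2)[OF \<open>k \<ge> 2\<close>] R[of "k - 1"] \<open>k \<ge> 2\<close> unfolding good_def by simp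
    qed
    moreover have "Poly_Mapping.keys m \<subseteq> {1..k} \<and> monom_degree m \<le> k"
      if m: "m \<in> Poly_Mapping.keys P" for m
    proof -
      have "m = Poly_Mapping.single k 1 \<or> (\<exists>j\<in>{1..<k}. m \<in> Poly_Mapping.keys (T j))"
        using m keys_add[of "Poly_Mapping.single (Poly_Mapping.single k 1) (\<alpha> k)" "\<Sum>j=1..<k. T j"]
          keys_sum[of T "{1..<k}"]
        unfolding P_def by (auto split: if_splits)
      then show ?thesis
      proof
        assume "m = Poly_Mapping.single k 1"
        then show ?thesis
          using less.prems by simp
      next
        assume "\<exists>j\<in>{1..<k}. m \<in> Poly_Mapping.keys (T j)"
        then obtain j m' where j: "j \<in> {1..<k}" and m': "m' \<in> Poly_Mapping.keys (R (k - j))"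
          and m_eq: "m = Poly_Mapping.single j 1 + m'"
          using T_keys by blast
        have "good (k - j) (R (k - j))"
          using j by (intro R) auto
        then have "Poly_Mapping.keys m' \<subseteq> {1..k - j}" "monom_degree m' \<le> k - j"
          using m' unfolding good_def by blast+
        moreover have "{1..k - j} \<subseteq> {1..k}"
          by auto
        ultimately have "Poly_Mapping.keys m' \<subseteq> {1..k}" "monom_degree m' \<le> k - j"
          by blast+
        \<comment> \<open>The extra variable costs one degree, and \<open>1 + (k - j)\<close> is at
          most \<open>k\<close> because \<open>j\<close> is at least 1.\<close>
        then show ?thesis
          using j by (auto simp: m_eq keys_plus_nat monom_degree_add)
      qed
    qed
    moreover have "y k = multipoly_eval P x" if "conv_recurrence \<alpha> \<beta> x y" for x y
    proof -
      have "y (k - j) = multipoly_eval (R (k - j)) x" if "j \<in> {1..<k}" for j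
      proof -
        have "good (k - j) (R (k - j))"
          using that by (intro R) auto
        then show ?thesis
          using \<open>conv_recurrence \<alpha> \<beta> x y\<close> unfolding good_def by blast
      qed
      moreover have "y k = \<alpha> k * x k + (\<Sum>j=1..<k. \<beta> k j * x j * y (k - j))"
        using \<open>conv_recurrence \<alpha> \<beta> x y\<close> less.prems unfolding conv_recurrence_def by blast
      ultimately show ?thesis
        by (simp add: P_def T_def multipoly_eval_add multipoly_eval_sum multipoly_eval_single
            multipoly_eval_single_times)
    qed
    ultimately have "good k P"
      unfolding good_def by blast
    then show ?case
      by blast
  qed
  then obtain P where P: "good k P"
    by blast
  show ?thesis
  proof (rule that[of P])
    show "multipoly_vars P \<subseteq> {1..k}"
      using P unfolding multipoly_vars_def good_def by blast
    show "total_degree P = k"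
      using P by (intro total_degree_eqI[where m = "Poly_Mapping.single 1 k"]) (auto simp: in_keys_iff good_def)
    show "y k = multipoly_eval P x"
      if "conv_recurrence \<alpha> \<beta> x y" for x y
      using P that unfolding good_def by blast
  qed
qed

section \<open>The recurrence between the two sequences of coefficients\<close>

text \<open>Bridge from convergent series on the disc to formal power series, where coefficients can
  be compared algebraically.\<close>

lemma powser_has_fps_expansion:
  fixes b :: "nat \<Rightarrow> complex"
  assumes "b 0 = 0" and summ: "\<And>z. norm z < 1 \<Longrightarrow> summable (\<lambda>k. b (Suc k) * z ^ Suc k)"
  shows "(\<lambda>z. suminf (\<lambda>k. b (Suc k) * z ^ Suc k)) has_fps_expansion Abs_fps b"
proof -
  have sums: "(\<lambda>k. b k * z ^ k) sums suminf (\<lambda>k. b (Suc k) * z ^ Suc k)" if "norm z < 1" for z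
    using summable_sums[OF summ[OF that]] sums_Suc_iff[of "\<lambda>k. b k * z ^ k"] \<open>b 0 = 0\<close> by simp
  \<comment> \<open>Convergence at one nonzero point suffices for a positive radius.\<close>
  have "summable (\<lambda>k. b k * (1 / 2) ^ k)"
    using sums[of "1 / 2"] by (simp add: sums_iff)
  then have "ereal (norm (1 / 2 :: complex)) \<le> fps_conv_radius (Abs_fps b)"
    unfolding fps_conv_radius_def by (intro conv_radius_geI) simp
  moreover have "0 < ereal (norm (1 / 2 :: complex))"
    by simp
  ultimately have "fps_conv_radius (Abs_fps b) > 0"
    by (rule order_less_le_trans[rotated])
  moreover have "eventually (\<lambda>z. z \<in> ball (0 :: complex) 1) (nhds 0)"
    by (intro eventually_nhds_in_open) auto
  then have "eventually (\<lambda>z. eval_fps (Abs_fps b) z = suminf (\<lambda>k. b (Suc k) * z ^ Suc k)) (nhds 0)"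
    by eventually_elim (use sums in \<open>auto simp: eval_fps_def sums_iff\<close>)
  ultimately show ?thesis
    unfolding has_fps_expansion_def by blast
qed

text \<open>Both sides of the defining identity have formal expansions at 0, and such expansions are
  unique.\<close>

lemma nonlinear_coeff_fps:
  fixes f :: "real \<Rightarrow> real"
  defines "w \<equiv> - 2 * of_real pi * \<i>" and "e \<equiv> \<i> * exp (of_real pi * \<i> * fourier_coeff f 0)"
  defines "A \<equiv> Abs_fps (\<lambda>n. if n = 0 then 0 else fourier_coeff f (int n))"
  shows "fps_exp w oo A = 1 - fps_const e * Abs_fps (nonlinear_coeff f)"
proof -
  let ?s = "nonlinear_coeff f"
  let ?g = "\<lambda>z. suminf (\<lambda>k. fourier_coeff f (int (Suc k)) * z ^ Suc k)"
  let ?h = "\<lambda>z. suminf (\<lambda>k. ?s (Suc k) * z ^ Suc k)"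
  have "?s 0 = 0 \<and> is_nonlinear_coeffs f ?s"
    unfolding nonlinear_coeff_def by (rule theI'[OF nonlinear_coeff_ex1])
  then have s0: "?s 0 = 0" and s_summable: "\<And>z. norm z < 1 \<Longrightarrow> summable (\<lambda>k. ?s (Suc k) * z ^ Suc k)"
    and eq: "\<And>z. norm z < 1 \<Longrightarrow> exp (w * ?g z) = 1 - e * ?h z"
    unfolding is_nonlinear_coeffs_def w_def e_def by auto
  have g: "?g has_fps_expansion A"
    unfolding A_def
    using powser_has_fps_expansion[of "\<lambda>n. if n = 0 then 0 else fourier_coeff f (int n)"]
      fourier_series_summable[of _ f] by simp
  \<comment> \<open>Composition requires the inner series to have constant term 0; the zeroth
    Fourier coefficient enters only through \<open>e\<close>.\<close>
  have lhs: "((\<lambda>z. exp (w * z)) \<circ> ?g) has_fps_expansion (fps_exp w oo A)"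
    by (intro has_fps_expansion_compose has_fps_expansion_exp g) (simp add: A_def)
  have rhs: "(\<lambda>z. 1 - e * ?h z) has_fps_expansion (1 - fps_const e * Abs_fps ?s)"
    by (intro fps_expansion_intros powser_has_fps_expansion s0 s_summable)
  have "eventually (\<lambda>z. z \<in> ball (0 :: complex) 1) (nhds 0)"
    by (intro eventually_nhds_in_open) auto
  then have "eventually (\<lambda>z. ((\<lambda>z. exp (w * z)) \<circ> ?g) z = 1 - e * ?h z) (nhds 0)"
    by eventually_elim (use eq in auto)
  then have "((\<lambda>z. exp (w * z)) \<circ> ?g) has_fps_expansion (1 - fps_const e * Abs_fps ?s)"
    using rhs by (subst has_fps_expansion_cong[OF _ refl])
  then show ?thesis
    by (rule fps_expansion_unique_complex[OF lhs])
qed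

lemma fourier_nonlinear_recurrence:
  fixes f :: "real \<Rightarrow> real"
  defines "w \<equiv> - 2 * of_real pi * \<i>" and "e \<equiv> \<i> * exp (of_real pi * \<i> * fourier_coeff f 0)"
  assumes "n \<ge> 1"
  shows "- e * of_nat n * nonlinear_coeff f n = w * (of_nat n * fourier_coeff f (int n)
    - e * (\<Sum>j=1..<n. of_nat j * fourier_coeff f (int j) * nonlinear_coeff f (n - j)))"
proof -
  let ?s = "nonlinear_coeff f"
  define A where "A = Abs_fps (\<lambda>n. if n = 0 then 0 else fourier_coeff f (int n))"
  define E where "E = 1 - fps_const e * Abs_fps ?s"
  have exp_A: "fps_exp w oo A = E"
    unfolding w_def e_def A_def E_def by (rule nonlinear_coeff_fps)
  have E0: "fps_nth E 0 = 1"
    unfolding exp_A[symmetric] by (simp add: fps_compose_nth)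
  have E_nth: "fps_nth E i = - e * ?s i" if "i \<noteq> 0" for i
    using that by (simp add: E_def)
  have "fps_deriv E = fps_const w * (E * fps_deriv A)"
    unfolding exp_A[symmetric]
    by (simp add: fps_compose_deriv A_def fps_compose_mult_distrib mult.assoc)
  \<comment> \<open>The factor \<open>fps_X\<close> undoes the index shift of the derivative, so the
    coefficient at \<open>n\<close> is \<open>n\<close> times the original one.\<close>
  then have "fps_X * fps_deriv E = fps_const w * ((fps_X * fps_deriv A) * E)"
    by (simp only: mult_ac)
  then have "fps_nth (fps_X * fps_deriv E) n = w * fps_nth ((fps_X * fps_deriv A) * E) n"
    by (simp only: fps_mult_left_const_nth)
  moreover have "fps_nth (fps_X * fps_deriv E) n = - e * of_nat n * ?s n"
    using \<open>n \<ge> 1\<close> by (simp add: E_nth)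
  moreover have "fps_nth ((fps_X * fps_deriv A) * E) n =
      of_nat n * fourier_coeff f (int n) -
      e * (\<Sum>j=1..<n. of_nat j * fourier_coeff f (int j) * ?s (n - j))"
  proof -
    have "fps_nth ((fps_X * fps_deriv A) * E) n =
        (\<Sum>j=0..n. of_nat j * fourier_coeff f (int j) * fps_nth E (n - j))"
      unfolding fps_mult_nth[of "fps_X * fps_deriv A"]
      by (intro sum.cong) (auto simp: A_def)
    \<comment> \<open>The term \<open>j = 0\<close> vanishes by its factor \<open>j\<close>. The
      term \<open>j = n\<close> is split off next, since it involves the constant term 1 of
      \<open>E\<close>.\<close>
    also have "\<dots> = (\<Sum>j=1..<Suc n. of_nat j * fourier_coeff f (int j) * fps_nth E (n - j))"
      by (intro sum.mono_neutral_right) auto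
    also have "\<dots> = of_nat n * fourier_coeff f (int n) +
        (\<Sum>j=1..<n. of_nat j * fourier_coeff f (int j) * fps_nth E (n - j))"
      using \<open>n \<ge> 1\<close> by (simp add: E0)
    also have "(\<Sum>j=1..<n. of_nat j * fourier_coeff f (int j) * fps_nth E (n - j)) =
        (\<Sum>j=1..<n. - e * (of_nat j * fourier_coeff f (int j) * ?s (n - j)))"
      by (intro sum.cong) (auto simp: E_nth)
    finally show ?thesis
      by (simp add: sum_distrib_left sum_negf)
  qed
  ultimately show ?thesis
    by simp
qed

section \<open>Both transformation rules from one recurrence\<close>

theorem theorem6:
  fixes k :: nat and a :: complex
  assumes "k \<ge> 1"
  shows "\<exists>P Q :: complex multipoly.
    multipoly_vars P \<subseteq> {1..k} \<and> total_degree P = k \<and>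
    multipoly_vars Q \<subseteq> {1..k} \<and> total_degree Q = k \<and>
    (\<forall>f :: real \<Rightarrow> real. f absolutely_integrable_on {0..<2 * pi} \<and> fourier_coeff f 0 = a \<longrightarrow>
       nonlinear_coeff f k = multipoly_eval P (\<lambda>j. fourier_coeff f (int j)) \<and>
       fourier_coeff f (int k) = multipoly_eval Q (nonlinear_coeff f))"
proof -
  \<comment> \<open>\<open>w\<close> is a constant and \<open>e\<close> depends on \<open>a\<close>
    alone, so the polynomials built from them serve every \<open>f\<close> with this mean.\<close>
  define w where "w = - 2 * of_real pi * \<i>"
  define e where "e = \<i> * exp (of_real pi * \<i> * a)"
  have nz: "w \<noteq> 0" "e \<noteq> 0"
    by (auto simp: w_def e_def)
  \<comment> \<open>These come from dividing the recurrence by \<open>- e * n\<close> to isolate the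
    nonlinear coefficient.\<close>
  let ?\<alpha> = "\<lambda>n::nat. - w / e" and ?\<beta> = "\<lambda>n j. w * of_nat j / of_nat n"
  obtain P :: "complex multipoly" where P: "multipoly_vars P \<subseteq> {1..k}" "total_degree P = k"
    "\<And>x y. conv_recurrence ?\<alpha> ?\<beta> x y \<Longrightarrow> y k = multipoly_eval P x"
    using conv_recurrence_multipoly[of ?\<alpha> ?\<beta> k] nz assms by auto
  \<comment> \<open>Dividing by \<open>w * n\<close> isolates the Fourier coefficient instead. The
    weight is now \<open>n - j\<close>, so the value at \<open>j = 1\<close> is nonzero exactly from
    \<open>n = 2\<close> on.\<close>
  let ?\<alpha>' = "\<lambda>n::nat. - e / w" and ?\<beta>' = "\<lambda>n j. e * of_nat (n - j) / of_nat n"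
  obtain Q :: "complex multipoly" where Q: "multipoly_vars Q \<subseteq> {1..k}" "total_degree Q = k"
    "\<And>x y. conv_recurrence ?\<alpha>' ?\<beta>' x y \<Longrightarrow> y k = multipoly_eval Q x"
    using conv_recurrence_multipoly[of ?\<alpha>' ?\<beta>' k] nz assms by auto
  have "nonlinear_coeff f k = multipoly_eval P (\<lambda>j. fourier_coeff f (int j)) \<and>
      fourier_coeff f (int k) = multipoly_eval Q (nonlinear_coeff f)"
    if f: "fourier_coeff f 0 = a" for f
  proof
    let ?c = "\<lambda>n. fourier_coeff f (int n)" and ?s = "nonlinear_coeff f"
    let ?S = "\<lambda>n. \<Sum>j=1..<n. of_nat j * ?c j * ?s (n - j)"
    have rec: "- e * of_nat n * ?s n = w * (of_nat n * ?c n - e * ?S n)" if "n \<ge> 1" for n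
      using fourier_nonlinear_recurrence[OF that, of f] unfolding f w_def e_def .
    show "?s k = multipoly_eval P ?c"
    proof (rule P(3), unfold conv_recurrence_def, intro allI impI)
      fix n :: nat assume n: "n \<ge> 1"
      have "?s n = - w / e * ?c n + w / of_nat n * ?S n"
        using rec[OF n] n nz by (simp add: field_simps)
      then show "?s n = - w / e * ?c n + (\<Sum>j=1..<n. w * of_nat j / of_nat n * ?c j * ?s (n - j))"
        by (simp add: sum_distrib_left mult_ac)
    qed
    show "?c k = multipoly_eval Q ?s"
    proof (rule Q(3), unfold conv_recurrence_def, intro allI impI)
      fix n :: nat assume n: "n \<ge> 1"
      \<comment> \<open>Reversing the summation exchanges the roles of the two sequences.\<close>
      have S: "?S n = (\<Sum>j=1..<n. of_nat (n - j) * ?s j * ?c (n - j))"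
        by (rule sum.reindex_bij_witness[of _ "\<lambda>j. n - j" "\<lambda>j. n - j"]) auto
      have "?c n = - e / w * ?s n + e / of_nat n * ?S n"
        using rec[OF n] n nz by (simp add: field_simps)
      then show "?c n = - e / w * ?s n + (\<Sum>j=1..<n. e * of_nat (n - j) / of_nat n * ?s j * ?c (n - j))"
        unfolding S by (simp add: sum_distrib_left mult_ac)
    qed
  qed
  then show ?thesis
    using P(1,2) Q(1,2) by blast
qed

end
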